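(* Let $\mathbb{F}_q$ be a finite field, let $f\in\mathbb{F}_q[x]$ be a nonzero monic polynomial, and let $D=\{f_1,\ldots,f_k\}$ (the $f_i$ distinct) be a set of monic divisors of $f$ with $f\notin D$ such that the gcd-graph $G_f(D)$ is both connected and anti-connected. Let $g$ be a monic divisor of $f$ and let $I$ be the ideal of $\mathbb{F}_q[x]/(f)$ generated by $g$. Assume that $f_i\nmid f_j$ for all $i\ne j$ and that $\gcd(f_1,f_2,\ldots,f_k)=1$. Then $I$ is a homogeneous set in $G_f(D)$ if and only if the following conditions hold: (1) $f_i\mid g$ for all $1\le i\le k$; (2) for all $1\le i\le k$, \[ \mathrm{rad}\left(\frac{g}{f_i}\right)=\mathrm{rad}\left(\frac{f}{f_i}\right). \] In particular, if $f$ is squarefree and $I$ is a homogeneous set in $G_f(D)$, then $f=g$.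
   Context: All polynomials are monic unless stated otherwise and gcd's are taken monic (so $\gcd(0,f)=f$). $\mathrm{rad}(h)$ is the product of the distinct monic irreducible factors of $h$. For a nonzero monic $f\in\mathbb{F}_q[x]$ and a set $D$ of monic divisors of $f$ with $f\notin D$, the gcd-graph $G_f(D)$ is the undirected loopless graph with vertex set the ring $\mathbb{F}_q[x]/(f)$ in which two vertices $u,v$ are adjacent if and only if $\gcd(u-v,f)\in D$. A graph is anti-connected if its complement is connected. A homogeneous set in a graph $G$ is a set $X\subseteq V(G)$ such that every vertex in $V(G)\setminus X$ is adjacent to either all or none of the vertices of $X$.
   Formalization: The case g = 1 is excluded: there I is the whole vertex set, which is trivially homogeneous, while conditions (1) and (2) always fail, so the claim is false for g = 1 (e.g. q = 3, f = x(x−1), D = {1}). *)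

theory Defs
  imports
    "HOL-Algebra.Algebraic_Closure_Type"
    "HOL-Algebra.QuotRing"
    "Graph_Theory.Graph_Theory"
    "HOL-Computational_Algebra.Computational_Algebra"
begin

text \<open>
  The finite field is a type of sort \<open>{field_gcd, finite}\<close>. Beyond \<^class>\<open>field\<close>, the class
  \<^class>\<open>field_gcd\<close> only fixes the trivial divisibility operations that every field carries; it is
  the library's condition for \<^const>\<open>gcd\<close> on polynomials, which is monic with \<open>gcd 0 f = f\<close>
  for monic \<open>f\<close>.
\<close>

abbreviation poly_ring :: "'a::field poly ring" where
  "poly_ring \<equiv> ring_of_type_algebra"

definition poly_quot :: "'a::field poly \<Rightarrow> 'a poly set ring" where
  "poly_quot f = poly_ring Quot (PIdl\<^bsub>poly_ring\<^esub> f)"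

definition poly_class :: "'a::field poly \<Rightarrow> 'a poly \<Rightarrow> 'a poly set" where
  "poly_class f p = PIdl\<^bsub>poly_ring\<^esub> f +>\<^bsub>poly_ring\<^esub> p"

text \<open>
  As usual in \<open>Graph_Theory\<close>, an undirected graph is a symmetric digraph. The greatest common
  divisor of \<open>f\<close> and a residue class is that of \<open>f\<close> and any representative; see
  \<open>adj_gcd_graph_iff\<close> below for independence of the choice.
\<close>

definition gcd_graph ::
    "'a::field_gcd poly \<Rightarrow> 'a poly set \<Rightarrow> 'a poly set pair_pre_digraph" where
  "gcd_graph f D =
     \<lparr> pverts = carrier (poly_quot f),
       parcs = {(u, v). u \<in> carrier (poly_quot f) \<and> v \<in> carrier (poly_quot f) \<and> u \<noteq> v \<and>
                  (\<exists>p \<in> u \<ominus>\<^bsub>poly_quot f\<^esub> v. gcd p f \<in> D)} \<rparr>"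

definition complement_graph :: "'v pair_pre_digraph \<Rightarrow> 'v pair_pre_digraph" where
  "complement_graph G =
     \<lparr> pverts = pverts G,
       parcs = {(u, v). u \<in> pverts G \<and> v \<in> pverts G \<and> u \<noteq> v \<and> (u, v) \<notin> parcs G} \<rparr>"

definition graph_connected :: "'v pair_pre_digraph \<Rightarrow> bool" where
  "graph_connected G \<longleftrightarrow> Digraph_Component.connected (with_proj G)"

definition anti_connected :: "'v pair_pre_digraph \<Rightarrow> bool" where
  "anti_connected G \<longleftrightarrow> graph_connected (complement_graph G)"

text \<open>
  The whole vertex set and all singletons are homogeneous in this sense.  In particular the ideal
  generated by \<open>1\<close> is always homogeneous, so statements characterising homogeneous ideals have
  to exclude it.
\<close>

definition homogeneous_set :: "'v pair_pre_digraph \<Rightarrow> 'v set \<Rightarrow> bool" where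
  "homogeneous_set G S \<longleftrightarrow> S \<subseteq> pverts G \<and>
     (\<forall>v \<in> pverts G - S. (\<forall>x \<in> S. (v, x) \<in> parcs G) \<or> (\<forall>x \<in> S. (v, x) \<notin> parcs G))"

definition rad :: "'a::field poly \<Rightarrow> 'a poly" where
  "rad h = \<Prod>{p. lead_coeff p = 1 \<and> irreducible p \<and> p dvd h}"

lemma mem_poly_class_iff: "q \<in> poly_class f p \<longleftrightarrow> f dvd q - p" for f p q :: "'a::field poly"
  unfolding poly_class_def a_r_coset_def' cgenideal_def ring_of_type_algebra_def
  by (auto simp: dvd_def algebra_simps)

lemma carrier_poly_quot: "carrier (poly_quot f) = range (poly_class f)"
  for f :: "'a::field poly"
  unfolding poly_quot_def FactRing_def A_RCOSETS_def' poly_class_def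
  by (auto simp: ring_of_type_algebra_def)

lemma poly_class_eq_iff: "poly_class f p = poly_class f q \<longleftrightarrow> f dvd p - q"
  for f p q :: "'a::field poly"
proof
  assume "poly_class f p = poly_class f q"
  moreover have "p \<in> poly_class f p" by (simp add: mem_poly_class_iff)
  ultimately show "f dvd p - q" by (simp add: mem_poly_class_iff)
next
  assume *: "f dvd p - q"
  have "f dvd r - p \<longleftrightarrow> f dvd r - q" for r
    using dvd_add_left_iff[OF *, of "r - p"] by simp
  thus "poly_class f p = poly_class f q" by (auto simp: mem_poly_class_iff)
qed

lemma poly_class_minus:
  fixes f p q :: "'a::field poly"
  shows "poly_class f p \<ominus>\<^bsub>poly_quot f\<^esub> poly_class f q = poly_class f (p - q)"
proof -
  let ?R = "poly_ring :: 'a poly ring"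
  interpret R: cring ?R by (rule cring_from_type_algebra)
  have id: "ideal (PIdl\<^bsub>?R\<^esub> f) ?R"
    by (rule R.cgenideal_ideal) (simp add: ring_of_type_algebra_def)
  interpret Q: ring "poly_quot f"
    unfolding poly_quot_def by (rule ideal.quotient_is_ring[OF id])
  have add: "poly_class f a \<oplus>\<^bsub>poly_quot f\<^esub> poly_class f b = poly_class f (a + b)" for a b
    using abelian_subgroup.a_rcos_sum[OF abelian_subgroupI3[OF ideal.axioms(1)[OF id] R.is_abelian_group], of a b]
    by (simp add: poly_quot_def FactRing_def poly_class_def ring_of_type_algebra_def)
  have carr: "poly_class f a \<in> carrier (poly_quot f)" for a
    by (simp add: carrier_poly_quot)
  have "poly_class f p = poly_class f (p - q) \<oplus>\<^bsub>poly_quot f\<^esub> poly_class f q"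
    by (simp add: add)
  thus ?thesis
    by (simp add: carr Q.minus_eq Q.a_assoc Q.r_neg)
qed

lemma adj_gcd_graph_iff:
  fixes f p q :: "'a::field_gcd poly"
  shows "(poly_class f p, poly_class f q) \<in> parcs (gcd_graph f D) \<longleftrightarrow>
           \<not> f dvd p - q \<and> gcd (p - q) f \<in> D"
proof -
  have "gcd r f = gcd (p - q) f" if "f dvd r - (p - q)" for r
  proof -
    from that obtain k where "r = (p - q) + k * f" by (metis diff_eq_eq add.commute dvd_def mult.commute)
    thus ?thesis by (metis gcd_add_mult gcd.commute add.commute)
  qed
  moreover have "f dvd (p - q) - (p - q)" by simp
  ultimately have "(\<exists>r. f dvd r - (p - q) \<and> gcd r f \<in> D) \<longleftrightarrow> gcd (p - q) f \<in> D"
    by (metis (no_types, lifting))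
  thus ?thesis
    by (auto simp: gcd_graph_def carrier_poly_quot poly_class_minus poly_class_eq_iff
        mem_poly_class_iff Bex_def)
qed

end

theory Submission
  imports Defs
begin

text \<open>
  A vertex is a residue class modulo \<open>f\<close>, and since \<open>g\<close> divides \<open>f\<close>, the ideal \<open>I\<close> consists of the
  classes of the multiples of \<open>g\<close>. Hence \<open>I\<close> is homogeneous exactly when membership of \<open>gcd v f\<close>
  in \<open>D\<close> does not change under translating \<open>v\<close> by multiples of \<open>g\<close>, for every \<open>v\<close> outside
  \<open>I\<close> (\<open>homogeneous_ideal_iff\<close>). What remains is divisibility theory.

  Suppose that \<open>I\<close> is homogeneous and let \<open>h \<in> D\<close> with \<open>\<not> g dvd h\<close>. Every translate \<open>h - g * t\<close>
  then has its gcd with \<open>f\<close> in \<open>D\<close>. Two choices of \<open>t\<close> are decisive.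

  \<^item> The translates can make the gcd as small as possible, namely \<open>gcd h g\<close>
    (\<open>exists_translate_gcd_eq\<close>). This is a divisor of \<open>h\<close> in \<open>D\<close>, so the antichain condition forces
    \<open>gcd h g = h\<close>, that is, \<open>h dvd g\<close>. Since \<open>Gcd D = 1\<close>, some \<open>h\<close> is not a multiple of \<open>g\<close>;
    a multiple of \<open>g\<close> in \<open>D\<close> would then be a proper multiple of this \<open>h\<close>, so all elements of \<open>D\<close>
    are proper divisors of \<open>g\<close>.
  \<^item> If a prime \<open>p\<close> divides \<open>f div h\<close> but not \<open>g div h\<close>, then \<open>g div h\<close> is invertible modulo \<open>p\<close>,
    and some translate of \<open>h\<close> is a multiple of \<open>h * p\<close>. Its gcd with \<open>f\<close> is a proper multiple of \<open>h\<close>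
    in \<open>D\<close>, contrary to the antichain condition.

  Conversely, under (1) and (2) the gcd itself is invariant: after division by \<open>h = gcd v f\<close>, every
  prime factor of \<open>f div h\<close> divides \<open>g div h\<close>, so translating by multiples of \<open>g div h\<close> changes
  nothing modulo that prime (\<open>gcd_translate_eq\<close>). For squarefree \<open>f\<close>, a prime factor of
  \<open>f div g\<close> would by (2) divide \<open>g\<close> as well, and its square would divide \<open>f\<close>.
\<close>

section \<open>Greatest common divisors of translates\<close>

lemma not_coprime_prime_divisorE:
  fixes a b :: "'a::factorial_ring_gcd"
  assumes "\<not> coprime a b" and "b \<noteq> 0"
  obtains p where "prime p" "p dvd a" "p dvd b"
proof -
  obtain c where c: "c dvd a" "c dvd b" "\<not> is_unit c"
    using assms(1) by (rule not_coprimeE)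
  moreover have "c \<noteq> 0" using c(2) assms(2) by auto
  ultimately obtain p where "prime p" "p dvd c" using prime_divisor_exists by blast
  with c that show ?thesis using dvd_trans by blast
qed

text \<open>
  Every nonzero constant is a unit, so the normal form of a nonzero polynomial has
  leading coefficient \<open>normalize (lead_coeff p) = 1\<close>.
\<close>

lemma lead_coeff_eq_1_iff_normalize:
  fixes p :: "'a::field_gcd poly"
  assumes "p \<noteq> 0"
  shows "lead_coeff p = 1 \<longleftrightarrow> normalize p = p"
proof
  assume "lead_coeff p = 1"
  then show "normalize p = p" by (simp add: normalize_poly_eq_map_poly)
next
  assume "normalize p = p"
  then have "lead_coeff p = lead_coeff p div unit_factor (lead_coeff p)"
    by (metis coeff_normalize)
  also have "\<dots> = normalize (lead_coeff p)" by simp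
  also have "\<dots> = 1"
    using assms by (intro is_unit_normalize) (simp add: dvd_field_iff)
  finally show "lead_coeff p = 1" .
qed

lemma gcd_eq_monic_divisor:
  fixes f h :: "'a::field_gcd poly"
  assumes "lead_coeff h = 1" and "h dvd f"
  shows "gcd h f = h"
  using assms lead_coeff_eq_1_iff_normalize[of h] by (cases "h = 0") (simp_all add: gcd_proj1_if_dvd)

text \<open>
  Take for \<open>t\<close> the product of the primes of \<open>f\<close> that do not divide \<open>a\<close>: a prime of \<open>f\<close> then divides
  exactly one of \<open>a\<close> and \<open>b * t\<close>.
\<close>

lemma exists_translate_coprime:
  fixes a b f :: "'a::factorial_ring_gcd"
  assumes "coprime a b" and "f \<noteq> 0"
  shows "\<exists>t. coprime (a - b * t) f"
proof
  define t where "t = \<Prod>{q \<in> prime_factors f. \<not> q dvd a}"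
  show "coprime (a - b * t) f"
  proof (rule ccontr)
    assume "\<not> coprime (a - b * t) f"
    then obtain p where p: "prime p" "p dvd a - b * t" "p dvd f"
      using \<open>f \<noteq> 0\<close> by (rule not_coprime_prime_divisorE)
    show False
    proof (cases "p dvd a")
      case True
      with p have "p dvd b * t" by (metis dvd_diff_right_iff)
      moreover have "\<not> p dvd b"
        using True p(1) \<open>coprime a b\<close> by (metis coprime_common_divisor not_prime_unit)
      ultimately have "p dvd t" using p(1) by (simp add: prime_dvd_mult_iff)
      then obtain q where "q \<in> prime_factors f" "\<not> q dvd a" "p dvd q"
        unfolding t_def using p(1) by (auto simp: prime_dvd_prod_iff)
      with p(1) True show False by (metis in_prime_factors_imp_prime primes_dvd_imp_eq)
    next
      case False
      with p \<open>f \<noteq> 0\<close> have "p \<in> {q \<in> prime_factors f. \<not> q dvd a}"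
        by (simp add: prime_factors_dvd)
      then have "p dvd t"
        unfolding t_def by (intro dvd_prodI) simp_all
      then have "p dvd b * t" by simp
      with p(2) False show False by (metis dvd_diff_left_iff)
    qed
  qed
qed

lemma exists_translate_gcd_eq:
  fixes f g h :: "'a::field_gcd poly"
  assumes "f \<noteq> 0" and "g \<noteq> 0" and "g dvd f"
  shows "\<exists>t. gcd (h - g * t) f = gcd h g"
proof -
  define d where "d = gcd h g"
  have "d \<noteq> 0" using \<open>g \<noteq> 0\<close> by (simp add: d_def)
  obtain a b where ab: "h = a * d" "g = b * d" "coprime a b"
    using gcd_coprime_exists[of h g] \<open>d \<noteq> 0\<close> unfolding d_def by blast
  have "d dvd f" using gcd_dvd2 \<open>g dvd f\<close> unfolding d_def by (rule dvd_trans)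
  then obtain c where c: "f = d * c" by (rule dvdE)
  have "c \<noteq> 0" using c \<open>f \<noteq> 0\<close> by auto
  then obtain t where t: "coprime (a - b * t) c" using exists_translate_coprime ab(3) by blast
  have "h - g * t = d * (a - b * t)" by (simp add: ab algebra_simps)
  then have "gcd (h - g * t) f = normalize d * gcd (a - b * t) c"
    by (simp add: c gcd_mult_left normalize_mult)
  with t show ?thesis by (auto simp: d_def)
qed

text \<open>
  The hypothesis on the primes of \<open>f div h\<close> says that translation by multiples of \<open>g div h\<close> is
  invisible modulo each of them, so it cannot create a new common factor with \<open>f div h\<close>.
\<close>

lemma gcd_translate_eq:
  fixes f g v :: "'a::field_gcd poly"
  assumes "f \<noteq> 0" and v: "gcd v f = h" and "h dvd g"
    and primes: "\<And>p. prime p \<Longrightarrow> p dvd f div h \<Longrightarrow> p dvd g div h"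
  shows "gcd (v - g * t) f = h"
proof -
  have "h \<noteq> 0" using v \<open>f \<noteq> 0\<close> by auto
  obtain w c where wc: "v = w * h" "f = c * h" "coprime w c"
    using gcd_coprime_exists[of v f] \<open>h \<noteq> 0\<close> unfolding v by blast
  obtain b where b: "g = h * b" using \<open>h dvd g\<close> by blast
  have "coprime (w - b * t) c"
  proof (rule ccontr)
    assume "\<not> coprime (w - b * t) c"
    moreover have "c \<noteq> 0" using wc \<open>f \<noteq> 0\<close> by auto
    ultimately obtain p where p: "prime p" "p dvd w - b * t" "p dvd c"
      by (rule not_coprime_prime_divisorE)
    then have "p dvd b" using primes[of p] \<open>h \<noteq> 0\<close> by (simp add: wc b)
    then have "p dvd w" using p(2) by (metis dvd_diff_left_iff dvd_mult2)
    with p wc(3) show False by (metis coprime_common_divisor not_prime_unit)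
  qed
  moreover have "v - g * t = h * (w - b * t)" by (simp add: wc b algebra_simps)
  moreover have "normalize h = h" using v by auto
  ultimately show ?thesis by (simp add: wc(2) gcd_mult_left normalize_mult mult.commute[of c])
qed

section \<open>Radicals\<close>

lemma rad_eq_prod_prime_factors:
  fixes h :: "'a::field_gcd poly"
  assumes "h \<noteq> 0"
  shows "rad h = \<Prod>(prime_factors h)"
proof -
  have "lead_coeff p = 1 \<and> irreducible p \<longleftrightarrow> prime p" for p :: "'a poly"
    using lead_coeff_eq_1_iff_normalize[of p]
    by (cases "p = 0") (auto simp: prime_def prime_elem_iff_irreducible)
  then show ?thesis
    using assms by (simp add: rad_def prime_factors_dvd flip: conj_assoc)
qed

lemma prime_dvd_rad_iff:
  fixes h p :: "'a::field_gcd poly"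
  assumes "h \<noteq> 0" and "prime p"
  shows "p dvd rad h \<longleftrightarrow> p dvd h"
proof
  assume "p dvd rad h"
  then obtain q where "q \<in> prime_factors h" "p dvd q"
    using assms by (auto simp: rad_eq_prod_prime_factors prime_dvd_prod_iff)
  then show "p dvd h" by (meson dvd_trans in_prime_factors_imp_dvd)
next
  assume "p dvd h"
  with assms have "p \<in> prime_factors h" by (simp add: prime_factors_dvd)
  then show "p dvd rad h"
    unfolding rad_eq_prod_prime_factors[OF \<open>h \<noteq> 0\<close>] by (intro dvd_prodI) simp_all
qed

lemma rad_eq_iff:
  fixes a b :: "'a::field_gcd poly"
  assumes "a \<noteq> 0" and "b \<noteq> 0"
  shows "rad a = rad b \<longleftrightarrow> (\<forall>p. prime p \<longrightarrow> p dvd a \<longleftrightarrow> p dvd b)"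
proof
  assume "rad a = rad b"
  with assms show "\<forall>p. prime p \<longrightarrow> p dvd a \<longleftrightarrow> p dvd b" by (metis prime_dvd_rad_iff)
next
  assume "\<forall>p. prime p \<longrightarrow> p dvd a \<longleftrightarrow> p dvd b"
  with assms show "rad a = rad b"
    by (auto simp: rad_eq_prod_prime_factors prime_factors_dvd intro!: prod.cong)
qed

section \<open>Homogeneity of an ideal as a translation property\<close>

lemma poly_class_mult:
  fixes f p q :: "'a::field poly"
  shows "poly_class f p \<otimes>\<^bsub>poly_quot f\<^esub> poly_class f q = poly_class f (p * q)"
proof -
  let ?R = "poly_ring :: 'a poly ring"
  interpret R: cring ?R by (rule cring_from_type_algebra)
  have "ideal (PIdl\<^bsub>?R\<^esub> f) ?R"
    by (rule R.cgenideal_ideal) (simp add: ring_of_type_algebra_def)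
  from ideal.rcoset_mult_add[OF this, of p q] show ?thesis
    by (simp add: poly_quot_def FactRing_def poly_class_def ring_of_type_algebra_def)
qed

lemma cring_poly_quot: "cring (poly_quot f)"
  for f :: "'a::field poly"
proof -
  let ?R = "poly_ring :: 'a poly ring"
  interpret R: cring ?R by (rule cring_from_type_algebra)
  have "ideal (PIdl\<^bsub>?R\<^esub> f) ?R"
    by (rule R.cgenideal_ideal) (simp add: ring_of_type_algebra_def)
  then show ?thesis
    unfolding poly_quot_def by (rule ideal.quotient_is_cring) (rule R.is_cring)
qed

lemma genideal_poly_class:
  fixes f g :: "'a::field poly"
  shows "Idl\<^bsub>poly_quot f\<^esub> {poly_class f g} = (\<lambda>s. poly_class f (g * s)) ` UNIV"
proof -
  interpret Q: cring "poly_quot f" by (rule cring_poly_quot)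
  have "Idl\<^bsub>poly_quot f\<^esub> {poly_class f g} = PIdl\<^bsub>poly_quot f\<^esub> (poly_class f g)"
    by (rule Q.cgenideal_eq_genideal[symmetric]) (simp add: carrier_poly_quot)
  also have "\<dots> = (\<lambda>s. poly_class f (g * s)) ` UNIV"
    unfolding cgenideal_def carrier_poly_quot
    by (auto simp: poly_class_mult mult.commute[of g] intro: rangeI) (metis poly_class_mult rangeI)
  finally show ?thesis .
qed

lemma poly_class_in_genideal_iff:
  fixes f g p :: "'a::field poly"
  assumes "g dvd f"
  shows "poly_class f p \<in> Idl\<^bsub>poly_quot f\<^esub> {poly_class f g} \<longleftrightarrow> g dvd p"
proof
  assume "poly_class f p \<in> Idl\<^bsub>poly_quot f\<^esub> {poly_class f g}"
  then obtain s where "f dvd p - g * s"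
    by (auto simp: genideal_poly_class poly_class_eq_iff)
  with \<open>g dvd f\<close> have "g dvd p - g * s" by (rule dvd_trans)
  then show "g dvd p" by (simp add: dvd_diff_left_iff)
next
  assume "g dvd p"
  then show "poly_class f p \<in> Idl\<^bsub>poly_quot f\<^esub> {poly_class f g}"
    by (auto simp: genideal_poly_class dvd_def)
qed

text \<open>
  A vertex outside the ideal differs from every element of the ideal, so adjacency between them
  is a condition on the gcd alone. The vertex \<open>0\<close> of the ideal serves as the reference: being adjacent
  to all or to none of the ideal means being adjacent to each element exactly when adjacent to \<open>0\<close>.
\<close>

lemma homogeneous_ideal_iff:
  fixes f g :: "'a::field_gcd poly"
  assumes "g dvd f"
  shows "homogeneous_set (gcd_graph f D) (Idl\<^bsub>poly_quot f\<^esub> {poly_class f g}) \<longleftrightarrow>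
           (\<forall>v t. \<not> g dvd v \<longrightarrow> (gcd (v - g * t) f \<in> D \<longleftrightarrow> gcd v f \<in> D))"
    (is "homogeneous_set _ ?I \<longleftrightarrow> ?R")
proof -
  have verts: "pverts (gcd_graph f D) = range (poly_class f)"
    by (simp add: gcd_graph_def carrier_poly_quot)
  have adj: "(poly_class f v, poly_class f (g * t)) \<in> parcs (gcd_graph f D) \<longleftrightarrow>
               gcd (v - g * t) f \<in> D" if "\<not> g dvd v" for v t
  proof -
    have "\<not> g dvd v - g * t" using that by (simp add: dvd_diff_left_iff)
    then have "\<not> f dvd v - g * t" using \<open>g dvd f\<close> dvd_trans by blast
    then show ?thesis by (simp add: adj_gcd_graph_iff)
  qed
  have "homogeneous_set (gcd_graph f D) ?I \<longleftrightarrow>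
          (\<forall>v. \<not> g dvd v \<longrightarrow>
             (\<forall>t. gcd (v - g * t) f \<in> D) \<or> (\<forall>t. gcd (v - g * t) f \<notin> D))"
  proof -
    have "?I \<subseteq> range (poly_class f)" by (auto simp: genideal_poly_class)
    moreover have "(\<forall>u \<in> range (poly_class f) - ?I. P u) \<longleftrightarrow>
                     (\<forall>v. \<not> g dvd v \<longrightarrow> P (poly_class f v))" for P
      using poly_class_in_genideal_iff[OF \<open>g dvd f\<close>] by blast
    moreover have "(\<forall>x \<in> ?I. P x) \<longleftrightarrow> (\<forall>t. P (poly_class f (g * t)))" for P
      by (auto simp: genideal_poly_class)
    ultimately show ?thesis
      unfolding homogeneous_set_def verts by (simp add: adj)
  qed
  also have "\<dots> \<longleftrightarrow> ?R" by (metis diff_zero mult_zero_right)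
  finally show ?thesis .
qed

section \<open>Homogeneous ideals of gcd-graphs\<close>

text \<open>
  Invariance applies only to those \<open>h\<close> that are not multiples of \<open>g\<close>, where it puts \<open>gcd h g\<close>
  into the antichain and thus gives \<open>h dvd g\<close>. Multiples of \<open>g\<close> are ruled out by comparison with
  such an element, and \<open>Gcd D = 1\<close> provides one.
\<close>

lemma dvd_if_translation_invariant:
  fixes f g :: "'a::field_gcd poly"
  assumes "f \<noteq> 0" "g \<noteq> 0" "g dvd f" "\<not> is_unit g"
    and D_divisors: "\<forall>h\<in>D. lead_coeff h = 1 \<and> h dvd f"
    and antichain: "\<forall>h\<in>D. \<forall>h'\<in>D. h \<noteq> h' \<longrightarrow> \<not> h dvd h'"
    and "Gcd D = 1"
    and inv: "\<And>v t. \<not> g dvd v \<Longrightarrow> gcd (v - g * t) f \<in> D \<longleftrightarrow> gcd v f \<in> D"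
    and "h \<in> D"
  shows "h dvd g \<and> \<not> g dvd h"
proof -
  have gcd_D: "gcd k f = k" if "k \<in> D" for k
    using D_divisors that by (simp add: gcd_eq_monic_divisor)
  have dvd: "k dvd g" if k: "k \<in> D" "\<not> g dvd k" for k
  proof -
    obtain t where "gcd (k - g * t) f = gcd k g"
      using exists_translate_gcd_eq assms(1-3) by blast
    then have "gcd k g \<in> D" using inv[OF k(2), of t] k(1) gcd_D by simp
    then have "gcd k g = k" using antichain k(1) by (meson gcd_dvd1)
    then show ?thesis by (metis gcd_dvd2)
  qed
  obtain k where k: "k \<in> D" "\<not> g dvd k"
    using \<open>Gcd D = 1\<close> \<open>\<not> is_unit g\<close> by (metis Gcd_greatest)
  have "\<not> g dvd h"
  proof
    assume "g dvd h"
    then have "k dvd h" using dvd[OF k] dvd_trans by blast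
    then have "k = h" using antichain k(1) \<open>h \<in> D\<close> by blast
    with k(2) \<open>g dvd h\<close> show False by simp
  qed
  with dvd \<open>h \<in> D\<close> show ?thesis by blast
qed

text \<open>
  A prime \<open>p\<close> of \<open>f div h\<close> not dividing \<open>g div h\<close> makes \<open>(g div h) * t \<equiv> 1\<close>
  solvable modulo \<open>p\<close>; with this \<open>t\<close>, \<open>h - g * t\<close> and \<open>f\<close> have the common divisor \<open>h * p\<close>,
  although an antichain contains no proper multiple of \<open>h\<close>.
\<close>

lemma prime_dvd_if_translation_invariant:
  fixes f g h :: "'a::field_gcd poly"
  assumes "h \<noteq> 0" "h dvd g" "h dvd f" "h \<in> D"
    and antichain: "\<forall>k\<in>D. h \<noteq> k \<longrightarrow> \<not> h dvd k"
    and inv: "\<And>t. gcd (h - g * t) f \<in> D"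
    and p: "prime p" "p dvd f div h"
  shows "p dvd g div h"
proof (rule ccontr)
  assume "\<not> p dvd g div h"
  then have "coprime p (g div h)" using p(1) by (simp add: prime_imp_coprime)
  then obtain x t where xt: "x * p + t * (g div h) = 1"
    using bezout_coefficients_fst_snd[of p "g div h"] by (metis coprime_imp_gcd_eq_1)
  have "h - g * t = h * (1 - t * (g div h))"
    using \<open>h dvd g\<close> by (simp add: algebra_simps)
  also have "\<dots> = h * p * x"
    by (simp add: algebra_simps flip: xt)
  finally have "h * p dvd h - g * t" by simp
  moreover have "h * p dvd f"
    using p(2) \<open>h dvd f\<close> by (metis dvd_mult_div_cancel mult_dvd_mono dvd_refl)
  ultimately have hp: "h * p dvd gcd (h - g * t) f" by simp
  then have "h dvd gcd (h - g * t) f" by (rule dvd_mult_left)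
  then have "gcd (h - g * t) f = h" using antichain inv by metis
  with hp \<open>h \<noteq> 0\<close> have "is_unit p" by simp
  with p(1) show False by simp
qed

theorem proposition5p6:
  fixes f g :: "'a::{field_gcd, finite} poly" and D :: "'a poly set"
  assumes f_monic: "lead_coeff f = 1"
    and D_divisors: "\<forall>h\<in>D. lead_coeff h = 1 \<and> h dvd f"
    and f_notin_D: "f \<notin> D"
    and conn: "graph_connected (gcd_graph f D)"
    and anticonn: "anti_connected (gcd_graph f D)"
    and g_monic: "lead_coeff g = 1"
    and g_dvd: "g dvd f"
    and g_proper: "g \<noteq> 1"
    and D_antichain: "\<forall>h\<in>D. \<forall>h'\<in>D. h \<noteq> h' \<longrightarrow> \<not> h dvd h'"
    and D_coprime: "Gcd D = 1"
  defines "I \<equiv> Idl\<^bsub>poly_quot f\<^esub> {poly_class f g}"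
  shows "(homogeneous_set (gcd_graph f D) I \<longleftrightarrow>
            (\<forall>h\<in>D. h dvd g) \<and> (\<forall>h\<in>D. rad (g div h) = rad (f div h))) \<and>
         (squarefree f \<and> homogeneous_set (gcd_graph f D) I \<longrightarrow> f = g)"
proof -
  have nonzero: "f \<noteq> 0" "g \<noteq> 0" using f_monic g_monic by auto
  have nonunit: "\<not> is_unit g"
    using g_monic g_proper nonzero by (metis is_unit_normalize lead_coeff_eq_1_iff_normalize)
  have hom_iff: "homogeneous_set (gcd_graph f D) I \<longleftrightarrow>
      (\<forall>v t. \<not> g dvd v \<longrightarrow> (gcd (v - g * t) f \<in> D \<longleftrightarrow> gcd v f \<in> D))"
    unfolding I_def by (rule homogeneous_ideal_iff[OF g_dvd])
  have rad_iff: "rad (g div h) = rad (f div h) \<longleftrightarrow>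
      (\<forall>p. prime p \<longrightarrow> p dvd f div h \<longrightarrow> p dvd g div h)" if "h \<in> D" "h dvd g" for h
  proof -
    have "g div h \<noteq> 0" "f div h \<noteq> 0"
      using nonzero D_divisors that by (auto simp: dvd_div_eq_0_iff)
    moreover have "g div h dvd f div h"
      using D_divisors that g_dvd by (simp add: div_dvd_div)
    ultimately show ?thesis by (auto simp: rad_eq_iff intro: dvd_trans)
  qed

  have char: "homogeneous_set (gcd_graph f D) I \<longleftrightarrow>
      (\<forall>h\<in>D. h dvd g) \<and> (\<forall>h\<in>D. rad (g div h) = rad (f div h))" (is "?H \<longleftrightarrow> ?C")
  proof
    assume ?H
    then have inv: "gcd (v - g * t) f \<in> D \<longleftrightarrow> gcd v f \<in> D" if "\<not> g dvd v" for v t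
      using hom_iff that by blast
    have proper: "h dvd g \<and> \<not> g dvd h" if "h \<in> D" for h
      using dvd_if_translation_invariant[OF nonzero g_dvd nonunit D_divisors D_antichain D_coprime
          inv that] by blast
    have "p dvd g div h" if h: "h \<in> D" and p: "prime p" "p dvd f div h" for h p
    proof (rule prime_dvd_if_translation_invariant[OF _ _ _ h _ _ p])
      show "h \<noteq> 0" "h dvd f" using D_divisors h by auto
      show "h dvd g" using proper h by blast
      show "\<forall>k\<in>D. h \<noteq> k \<longrightarrow> \<not> h dvd k" using D_antichain h by blast
      have "gcd h f = h" using D_divisors h by (simp add: gcd_eq_monic_divisor)
      then show "gcd (h - g * t) f \<in> D" for t using inv[of h t] proper h by simp
    qed
    with proper rad_iff show ?C by blast
  next
    assume C: ?C
    have step: "gcd (v - g * t) f \<in> D" if v: "gcd v f \<in> D" for v t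
    proof -
      have "gcd (v - g * t) f = gcd v f"
        using C v rad_iff[of "gcd v f"] by (intro gcd_translate_eq nonzero(1)) blast+
      with v show ?thesis by simp
    qed
    have "gcd v f \<in> D" if "gcd (v - g * t) f \<in> D" for v t
      using step[OF that, of "- t"] by simp
    with step hom_iff show ?H by blast
  qed

  have "f = g" if "squarefree f" ?H
  proof (rule ccontr)
    assume "f \<noteq> g"
    obtain k where k: "f = g * k" using g_dvd by blast
    have "lead_coeff k = 1" using k f_monic g_monic by (simp add: lead_coeff_mult)
    moreover have "k \<noteq> 1" using k \<open>f \<noteq> g\<close> by auto
    moreover have "k \<noteq> 0" using k nonzero by auto
    ultimately have "\<not> is_unit k" by (metis is_unit_normalize lead_coeff_eq_1_iff_normalize)
    with \<open>k \<noteq> 0\<close> obtain p where p: "prime p" "p dvd k" using prime_divisor_exists by blast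
    have "D \<noteq> {}" using D_coprime by auto
    then obtain h where h: "h \<in> D" by blast
    with char \<open>?H\<close> have hg: "h dvd g" and rad: "rad (g div h) = rad (f div h)" by auto
    have "f div h = (g div h) * k" using hg by (simp add: k div_mult_swap mult.commute)
    then have "p dvd f div h" using p by simp
    then have "p dvd g div h" using rad rad_iff h hg p by blast
    then have "p dvd g" using hg by (metis dvd_mult_div_cancel dvd_mult)
    then have "p ^ 2 dvd f" using p by (auto simp: k power2_eq_square intro: mult_dvd_mono)
    with \<open>squarefree f\<close> have "is_unit p" by (auto dest: squarefreeD)
    with p show False by simp
  qed
  with char show ?thesis by blast
qed

end
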